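(* Let $\mathbb{D}=\{z\in\mathbb{C}:|z|<1\}$ and suppose $f:\mathbb{D}\to\mathbb{D}$ is holomorphic such that, for some sequence $(z_n)$ in $\mathbb{D}$ with $|z_n|\to 1$, $$ f^h(z_n)=1+o\big((1-|z_n|)^2\big)\qquad (n\to\infty). $$ Then $f\in \mathrm{Aut}(\mathbb{D})$.
   Context: For a holomorphic selfmap $f$ of $\mathbb{D}$, $f^h(z):=(1-|z|^2)\dfrac{|f'(z)|}{1-|f(z)|^2}$ for $z\in\mathbb{D}$. $\mathrm{Aut}(\mathbb{D})$ is the group of conformal automorphisms (bijective holomorphic selfmaps) of $\mathbb{D}$. *)

theory Defs
  imports "HOL-Complex_Analysis.Complex_Analysis" "HOL-Library.Landau_Symbols"
begin

abbreviation unit_disc :: "complex set" (\<open>\<bbbD>\<close>)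
  where "\<bbbD> \<equiv> ball 0 1"

definition hyperbolic_deriv :: "(complex \<Rightarrow> complex) \<Rightarrow> complex \<Rightarrow> real"
  where "hyperbolic_deriv f z = (1 - (cmod z)\<^sup>2) * (cmod (deriv f z) / (1 - (cmod (f z))\<^sup>2))"

text \<open>The elements of the automorphism group are represented by total functions, whose values
  outside the disc are irrelevant.\<close>

definition Aut_disc :: "(complex \<Rightarrow> complex) set"
  where "Aut_disc = {f. f holomorphic_on \<bbbD> \<and> bij_betw f \<bbbD> \<bbbD>}"

end

theory Submission
  imports Defs
begin

text \<open>Fix \<open>w\<close> and divide the pseudo-hyperbolic distance of \<open>f z\<close> and \<open>f w\<close> by that of \<open>z\<close> and \<open>w\<close>.
  Up to a factor of modulus one, this hyperbolic difference quotient is a holomorphic function of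
  \<open>z\<close> bounded by 1 (Schwarz-Pick), whose modulus at \<open>w\<close> is the hyperbolic derivative of \<open>f\<close> at \<open>w\<close>.
  Its modulus is symmetric in \<open>z\<close> and \<open>w\<close>, so applying a Harnack-type
  estimate for bounded functions twice, first along \<open>(0,0) \<rightarrow> (z,0)\<close> and then along
  \<open>(0,z) \<rightarrow> (z,z)\<close>, bounds \<open>1 - hyperbolic_deriv f z\<close> from below by a constant multiple of
  \<open>(1 - hyperbolic_deriv f 0) * (1 - |z|)\<^sup>2\<close> (a weak form of Golusin's inequality). Hence the
  assumption forces equality in the Schwarz-Pick inequality at the origin.\<close>

section \<open>Moebius maps of the disc and a Harnack-type estimate\<close>

abbreviation moebius :: "complex \<Rightarrow> complex \<Rightarrow> complex"
  where "moebius \<equiv> Moebius_function 0"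

lemma moebius_denom_nonzero:
  assumes "cmod w < 1" "cmod z < 1"
  shows "1 - cnj w * z \<noteq> 0"
proof -
  have "cmod (cnj w * z) < 1"
    using norm_mult_less[of "cnj w" 1 z 1] assms by simp
  then show ?thesis by auto
qed

text \<open>Turns a bound on a pseudo-hyperbolic distance into an inequality between the two
  moduli.\<close>

lemma one_minus_norm_moebius_squared:
  assumes "cmod w < 1" "cmod z < 1"
  shows "1 - (cmod (moebius w z))\<^sup>2 =
    (1 - (cmod w)\<^sup>2) * (1 - (cmod z)\<^sup>2) / (cmod (1 - cnj w * z))\<^sup>2"
proof -
  have "(cmod (1 - cnj w * z))\<^sup>2 - (cmod (z - w))\<^sup>2 = (1 - (cmod w)\<^sup>2) * (1 - (cmod z)\<^sup>2)"
    unfolding cmod_power2 by (simp add: power2_eq_square algebra_simps)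
  moreover have "(cmod (1 - cnj w * z))\<^sup>2 \<noteq> 0"
    using moebius_denom_nonzero[OF assms] by simp
  ultimately show ?thesis
    by (simp add: Moebius_function_simple norm_divide power_divide field_simps)
qed

lemma norm_moebius_commute: "cmod (moebius w z) = cmod (moebius z w)"
proof -
  have "cnj (1 - cnj w * z) = 1 - cnj z * w"
    by simp
  then have "cmod (1 - cnj w * z) = cmod (1 - cnj z * w)"
    by (metis complex_mod_cnj)
  then show ?thesis
    by (simp add: Moebius_function_simple norm_divide norm_minus_commute)
qed

lemma moebius_in_disc: "cmod w < 1 \<Longrightarrow> z \<in> \<bbbD> \<Longrightarrow> moebius w z \<in> \<bbbD>"
  by (simp add: Moebius_function_norm_lt_1)

lemma bij_betw_moebius:
  assumes "cmod w < 1"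
  shows "bij_betw (moebius w) \<bbbD> \<bbbD>"
  by (rule bij_betw_byWitness[where f' = "moebius (- w)"])
    (use assms in \<open>auto simp: Moebius_function_compose Moebius_function_norm_lt_1\<close>)

lemma moebius_has_field_derivative:
  assumes "cmod w < 1" "cmod z < 1"
  shows "(moebius w has_field_derivative (1 - (cmod w)\<^sup>2) / (1 - cnj w * z)\<^sup>2) (at z)"
proof -
  have "((\<lambda>z. (z - w) / (1 - cnj w * z)) has_field_derivative
    (1 - w * cnj w) / (1 - cnj w * z)\<^sup>2) (at z)"
    using moebius_denom_nonzero[OF assms]
    by (auto intro!: derivative_eq_intros simp: power2_eq_square algebra_simps)
  then show ?thesis
    by (simp only: Moebius_function_simple[abs_def] of_real_diff of_real_1 complex_norm_square)
qed

text \<open>Since \<open>moebius (- w)\<close> sends 0 to \<open>w\<close> and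
  \<open>moebius (f w)\<close> sends \<open>f w\<close> to 0, this map fixes 0, as the Schwarz lemma
  requires.\<close>

definition centred :: "(complex \<Rightarrow> complex) \<Rightarrow> complex \<Rightarrow> complex \<Rightarrow> complex"
  where "centred f w = moebius (f w) \<circ> f \<circ> moebius (- w)"

text \<open>The Schwarz lemma for \<open>moebius (g 0) \<circ> g\<close> limits how far
  \<open>g z\<close> can lie from \<open>g 0\<close>, hence how close its modulus can get to
  1.\<close>

lemma bounded_by_one_harnack:
  assumes holg: "g holomorphic_on \<bbbD>"
    and le1: "\<And>z. z \<in> \<bbbD> \<Longrightarrow> cmod (g z) \<le> 1"
    and z: "z \<in> \<bbbD>"
  shows "(1 - cmod (g 0)) * (1 - cmod z) \<le> 4 * (1 - cmod (g z))"
proof (cases "\<exists>u\<in>\<bbbD>. cmod (g u) = 1")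
  \<comment> \<open>By the maximum principle \<open>g\<close> is constant and both sides vanish.
    Otherwise the modulus stays below 1, as needed for \<open>moebius (g 0)\<close> to map the disc
    into itself.\<close>
  case True
  then obtain u where u: "u \<in> \<bbbD>" "cmod (g u) = 1" by blast
  have "g constant_on \<bbbD>"
    by (rule maximum_modulus_principle[where U = \<bbbD> and \<xi> = u]) (use holg u le1 in auto)
  then have "cmod (g z) = 1" "cmod (g 0) = 1"
    using u z unfolding constant_on_def by auto
  then show ?thesis by simp
next
  case False
  then have lt1: "cmod (g u) < 1" if "u \<in> \<bbbD>" for u
    using le1 that by force
  define a b r where "a = cmod (g 0)" and "b = cmod (g z)" and "r = cmod z"
  have a: "0 \<le> a" "a < 1" and b: "0 \<le> b" "b < 1" and r: "0 \<le> r" "r < 1"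
    using lt1 z by (auto simp: a_def b_def r_def)
  have "cmod ((moebius (g 0) \<circ> g) z) \<le> cmod z"
  proof (rule Schwarz_Lemma(1))
    show "moebius (g 0) \<circ> g holomorphic_on ball 0 1"
      by (rule holomorphic_on_compose_gen[OF holg Moebius_function_holomorphic]) (use lt1 in auto)
  qed (use lt1 z in \<open>auto simp: Moebius_function_eq_zero Moebius_function_norm_lt_1\<close>)
  then have "1 - r\<^sup>2 \<le> 1 - (cmod (moebius (g 0) (g z)))\<^sup>2"
    by (simp add: r_def power_mono)
  also have "\<dots> = (1 - a\<^sup>2) * (1 - b\<^sup>2) / (cmod (1 - cnj (g 0) * g z))\<^sup>2"
    using lt1 z by (simp add: one_minus_norm_moebius_squared a_def b_def)
  finally have *: "(1 - r\<^sup>2) * (cmod (1 - cnj (g 0) * g z))\<^sup>2 \<le> (1 - a\<^sup>2) * (1 - b\<^sup>2)"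
    using moebius_denom_nonzero[OF lt1 lt1, of 0 z] z by (simp add: field_simps)
  have "1 - a \<le> 1 - a * b"
    using a b by (simp add: mult_left_le)
  also have "\<dots> \<le> cmod (1 - cnj (g 0) * g z)"
    using norm_triangle_ineq2[of 1 "cnj (g 0) * g z"] by (simp add: a_def b_def norm_mult)
  finally have "(1 - a)\<^sup>2 \<le> (cmod (1 - cnj (g 0) * g z))\<^sup>2"
    using a by (simp add: power_mono)
  moreover have "1 - r \<le> 1 - r\<^sup>2" 
    using r by (simp add: power2_eq_square mult_left_le)
  ultimately have "(1 - r) * (1 - a)\<^sup>2 \<le> (1 - r\<^sup>2) * (cmod (1 - cnj (g 0) * g z))\<^sup>2"
    using r by (intro mult_mono) auto
  \<comment> \<open>Both sides are arranged to share one factor \<open>1 - a\<close>, which cancels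
    because it is positive; the surviving \<open>(1 + a) * (1 + b)\<close> is at most 4.\<close>
  with * have "(1 - a) * ((1 - a) * (1 - r)) \<le> (1 - a) * ((1 + a) * (1 + b) * (1 - b))"
    by (simp add: power2_eq_square algebra_simps)
  then have "(1 - a) * (1 - r) \<le> (1 + a) * (1 + b) * (1 - b)"
    using a by simp
  also have "\<dots> \<le> (2 * 2) * (1 - b)"
    using a b by (intro mult_right_mono mult_mono) auto
  finally show ?thesis
    by (simp add: a_def b_def r_def)
qed

section \<open>Self-maps of the disc: Schwarz-Pick, its equality case and difference
  quotients\<close>

context
  fixes f :: "complex \<Rightarrow> complex"
  assumes holf: "f holomorphic_on \<bbbD>"
    and self: "f ` \<bbbD> \<subseteq> \<bbbD>"
begin

lemma norm_self_map: "cmod z < 1 \<Longrightarrow> cmod (f z) < 1"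
  using self by (force simp: image_subset_iff)

lemma centred_holomorphic:
  assumes "w \<in> \<bbbD>"
  shows "centred f w holomorphic_on \<bbbD>"
  unfolding centred_def
proof (rule holomorphic_on_compose_gen[where t = \<bbbD>])
  show "moebius (- w) holomorphic_on \<bbbD>"
    using assms by (simp add: Moebius_function_holomorphic)
  show "moebius (f w) \<circ> f holomorphic_on \<bbbD>"
    by (rule holomorphic_on_compose_gen[OF holf Moebius_function_holomorphic self])
      (use assms norm_self_map in auto)
qed (use assms in \<open>auto simp: Moebius_function_norm_lt_1\<close>)

lemma centred_zero: "centred f w 0 = 0"
  by (simp add: centred_def Moebius_function_of_zero Moebius_function_eq_zero)

lemma norm_centred_less_1:
  assumes "w \<in> \<bbbD>" "cmod z < 1"
  shows "cmod (centred f w z) < 1"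
  using assms by (simp add: centred_def Moebius_function_norm_lt_1 norm_self_map)

lemma centred_moebius:
  assumes "w \<in> \<bbbD>" "z \<in> \<bbbD>"
  shows "centred f w (moebius w z) = moebius (f w) (f z)"
  using assms by (simp add: centred_def Moebius_function_compose)

text \<open>By the chain rule the inner and outer Moebius maps contribute exactly the two weights in
  the hyperbolic derivative.\<close>

lemma norm_deriv_centred:
  assumes w: "w \<in> \<bbbD>"
  shows "cmod (deriv (centred f w) 0) = hyperbolic_deriv f w"
proof -
  let ?c = "1 - (cmod (f w))\<^sup>2"
  have w0: "moebius (- w) 0 = w"
    by (simp add: Moebius_function_of_zero)
  have lt: "(cmod w)\<^sup>2 < 1" "(cmod (f w))\<^sup>2 < 1"
    using w norm_self_map by (auto simp: power_less_one_iff)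
  have 1: "(moebius (- w) has_field_derivative of_real (1 - (cmod w)\<^sup>2)) (at 0)"
    using moebius_has_field_derivative[of "- w" 0] w by simp
  have 2: "(f has_field_derivative deriv f w) (at (moebius (- w) 0))"
    using holomorphic_derivI[OF holf _ w] w0 by simp
  \<comment> \<open>At \<open>f w\<close> the numerator of the Moebius derivative is
    \<open>?c\<close> and its denominator is the square of \<open>?c\<close>.\<close>
  have "1 - cnj (f w) * f w = of_real ?c"
    by (simp only: of_real_diff of_real_1 complex_norm_square mult.commute)
  moreover have "of_real ?c / (of_real ?c)\<^sup>2 = complex_of_real (inverse ?c)"
    using lt by (simp add: power2_eq_square field_simps del: of_real_diff)
  ultimately have 3: "(moebius (f w) has_field_derivative of_real (inverse ?c))
      (at (f (moebius (- w) 0)))"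
    using moebius_has_field_derivative[of "f w" "f w"] w norm_self_map w0
    by (simp del: of_real_diff of_real_inverse)
  have "(centred f w has_field_derivative
      of_real (inverse ?c) * (deriv f w * of_real (1 - (cmod w)\<^sup>2))) (at 0)"
    unfolding centred_def comp_assoc
    by (rule DERIV_chain[OF _ DERIV_chain[OF 2 1]]) (use 3 in simp)
  then have "deriv (centred f w) 0 = of_real (inverse ?c) * (deriv f w * of_real (1 - (cmod w)\<^sup>2))"
    by (rule DERIV_imp_deriv)
  then show ?thesis
    using lt by (simp only: norm_mult norm_of_real) (simp add: hyperbolic_deriv_def field_simps)
qed

lemma hyperbolic_deriv_le_1: "w \<in> \<bbbD> \<Longrightarrow> hyperbolic_deriv f w \<le> 1"
  using Schwarz_Lemma(2)[OF centred_holomorphic centred_zero norm_centred_less_1, of w 0]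
  by (simp add: norm_deriv_centred)

text \<open>Equality in the Schwarz lemma makes \<open>centred f w\<close> a rotation; undoing both
  Moebius maps exhibits \<open>f\<close> as a composition of bijections of the disc.\<close>

lemma hyperbolic_deriv_eq_1_imp_Aut:
  assumes w: "w \<in> \<bbbD>" and eq: "hyperbolic_deriv f w = 1"
  shows "f \<in> Aut_disc"
proof -
  obtain \<alpha> where \<alpha>: "\<And>z. cmod z < 1 \<Longrightarrow> centred f w z = \<alpha> * z" "cmod \<alpha> = 1"
    using Schwarz_Lemma(3)[OF centred_holomorphic centred_zero norm_centred_less_1, of w 0]
      w eq by (auto simp: norm_deriv_centred)
  have w1: "cmod w < 1" "cmod (f w) < 1"
    using w norm_self_map by auto
  have "bij_betw ((*) \<alpha>) \<bbbD> \<bbbD>"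
    by (rule bij_betw_byWitness[where f' = "\<lambda>z. z / \<alpha>"])
      (use \<alpha>(2) in \<open>auto simp: norm_mult norm_divide\<close>)
  then have "bij_betw (moebius (- f w) \<circ> ((*) \<alpha> \<circ> moebius w)) \<bbbD> \<bbbD>"
    using bij_betw_moebius[of w] bij_betw_moebius[of "- f w"] w1
    by (auto intro!: bij_betw_trans)
  moreover have "(moebius (- f w) \<circ> ((*) \<alpha> \<circ> moebius w)) z = f z" if "z \<in> \<bbbD>" for z
  proof -
    have "\<alpha> * moebius w z = moebius (f w) (f z)"
      using \<alpha>(1)[of "moebius w z"] centred_moebius[OF w that] that w1
      by (simp add: Moebius_function_norm_lt_1)
    then show ?thesis
      using that w1 norm_self_map by (simp add: Moebius_function_compose)
  qed
  ultimately have "bij_betw f \<bbbD> \<bbbD>"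
    using bij_betw_cong by blast
  with holf show ?thesis
    by (simp add: Aut_disc_def)
qed

text \<open>As \<open>centred f w\<close> vanishes at 0, it equals \<open>z * h z\<close> with
  \<open>h\<close> holomorphic, and \<open>h \<circ> moebius w\<close> is the required quotient. The
  product form of the third property also covers \<open>z = w\<close>.\<close>

lemma hyperbolic_difference_quotient:
  assumes w: "w \<in> \<bbbD>"
  obtains g where "g holomorphic_on \<bbbD>" "\<And>z. z \<in> \<bbbD> \<Longrightarrow> cmod (g z) \<le> 1"
    "\<And>z. z \<in> \<bbbD> \<Longrightarrow> cmod (moebius w z) * cmod (g z) = cmod (moebius (f w) (f z))"
    "cmod (g w) = hyperbolic_deriv f w"
proof -
  obtain h where holh: "h holomorphic_on \<bbbD>"
    and h: "\<And>z. cmod z < 1 \<Longrightarrow> centred f w z = z * h z" and h0: "deriv (centred f w) 0 = h 0"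
    using Schwarz3[OF centred_holomorphic[OF w] centred_zero] by metis
  have w1: "cmod w < 1"
    using w by simp
  \<comment> \<open>The Schwarz bound on \<open>z * h z\<close> says nothing about
    \<open>h 0\<close>, which is instead a derivative controlled by Schwarz-Pick.\<close>
  have hle: "cmod (h z) \<le> 1" if z: "cmod z < 1" for z
  proof (cases "z = 0")
    case True
    then show ?thesis
      using hyperbolic_deriv_le_1[OF w] norm_deriv_centred[OF w] h0 by simp
  next
    case False
    have "cmod (centred f w z) \<le> cmod z"
      by (rule Schwarz_Lemma(1)[OF centred_holomorphic[OF w] centred_zero])
        (use norm_centred_less_1[OF w] z in auto)
    then show ?thesis
      using False z by (simp add: h norm_mult)
  qed
  show thesis
  proof (rule that[of "h \<circ> moebius w"])
    show "h \<circ> moebius w holomorphic_on \<bbbD>"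
      by (rule holomorphic_on_compose_gen[OF Moebius_function_holomorphic[OF w1] holh])
        (use moebius_in_disc[OF w1] in auto)
    show "cmod ((h \<circ> moebius w) z) \<le> 1" if "z \<in> \<bbbD>" for z
      using that w1 by (simp add: hle Moebius_function_norm_lt_1)
    show "cmod (moebius w z) * cmod ((h \<circ> moebius w) z) = cmod (moebius (f w) (f z))"
      if "z \<in> \<bbbD>" for z
      using that w1 h[of "moebius w z"] centred_moebius[OF w that]
      by (simp add: Moebius_function_norm_lt_1 flip: norm_mult)
    show "cmod ((h \<circ> moebius w) w) = hyperbolic_deriv f w"
      using norm_deriv_centred[OF w] h0 by (simp add: Moebius_function_eq_zero)
  qed
qed

text \<open>Each of the two Harnack steps costs a factor \<open>(1 - cmod z) / 4\<close>, whence the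
  square and the 16.\<close>

lemma golusin_weak:
  assumes z: "z \<in> \<bbbD>"
  shows "(1 - hyperbolic_deriv f 0) * (1 - cmod z)\<^sup>2 \<le> 16 * (1 - hyperbolic_deriv f z)"
proof -
  obtain g where g: "g holomorphic_on \<bbbD>" "\<And>u. u \<in> \<bbbD> \<Longrightarrow> cmod (g u) \<le> 1"
    "\<And>u. u \<in> \<bbbD> \<Longrightarrow> cmod (moebius 0 u) * cmod (g u) = cmod (moebius (f 0) (f u))"
    "cmod (g 0) = hyperbolic_deriv f 0"
    using hyperbolic_difference_quotient[of 0] by force
  obtain k where k: "k holomorphic_on \<bbbD>" "\<And>u. u \<in> \<bbbD> \<Longrightarrow> cmod (k u) \<le> 1"
    "\<And>u. u \<in> \<bbbD> \<Longrightarrow> cmod (moebius z u) * cmod (k u) = cmod (moebius (f z) (f u))"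
    "cmod (k z) = hyperbolic_deriv f z"
    using hyperbolic_difference_quotient[OF z] by metis
  \<comment> \<open>This symmetry links the two steps: both values belong to the pair 0,
    \<open>z\<close>. Cancelling \<open>cmod z\<close> requires \<open>z \<noteq> 0\<close>.\<close>
  have "cmod (g z) = cmod (k 0)"
  proof (cases "z = 0")
    case True
    then show ?thesis using g(4) k(4) by simp
  next
    case False
    have "cmod z * cmod (g z) = cmod z * cmod (k 0)"
      using g(3)[OF z] k(3)[of 0] norm_moebius_commute[of "f 0" "f z"]
      by (simp add: Moebius_function_simple)
    with False show ?thesis by simp
  qed
  then have step: "(1 - hyperbolic_deriv f 0) * (1 - cmod z) \<le> 4 * (1 - cmod (k 0))"
    using bounded_by_one_harnack[OF g(1,2) z] g(4) by simp
  have "(1 - hyperbolic_deriv f 0) * (1 - cmod z)\<^sup>2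
      \<le> 4 * ((1 - cmod (k 0)) * (1 - cmod z))"
    using mult_right_mono[OF step, of "1 - cmod z"] z by (simp add: power2_eq_square mult.assoc)
  also have "\<dots> \<le> 16 * (1 - hyperbolic_deriv f z)"
    using bounded_by_one_harnack[OF k(1,2) z] k(4) by simp
  finally show ?thesis .
qed

end

theorem theorem2p1:
  fixes f :: "complex \<Rightarrow> complex" and z :: "nat \<Rightarrow> complex"
  assumes "f holomorphic_on \<bbbD>"
    and "f ` \<bbbD> \<subseteq> \<bbbD>"
    and "\<And>n. z n \<in> \<bbbD>"
    and "(\<lambda>n. cmod (z n)) \<longlonglongrightarrow> 1"
    and "(\<lambda>n. hyperbolic_deriv f (z n) - 1) \<in> o(\<lambda>n. (1 - cmod (z n))\<^sup>2)"
  shows "f \<in> Aut_disc"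
proof (rule hyperbolic_deriv_eq_1_imp_Aut[OF assms(1,2), of 0])
  show "hyperbolic_deriv f 0 = 1"
  proof (rule ccontr)
    let ?d = "1 - hyperbolic_deriv f 0"
    assume "hyperbolic_deriv f 0 \<noteq> 1"
    then have d: "?d > 0"
      using hyperbolic_deriv_le_1[OF assms(1,2), of 0] by simp
    \<comment> \<open>The constant \<open>?d / 32\<close> is half of the \<open>?d / 16\<close> in
      \<open>golusin_weak\<close>, so together they bound a positive number by half of
      itself.\<close>
    then have "\<forall>\<^sub>F n in sequentially. norm (hyperbolic_deriv f (z n) - 1)
        \<le> (?d / 32) * norm ((1 - cmod (z n))\<^sup>2)"
      by (intro landau_o.smallD[OF assms(5)]) simp
    then obtain n where n: "norm (hyperbolic_deriv f (z n) - 1)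
        \<le> (?d / 32) * norm ((1 - cmod (z n))\<^sup>2)"
      using eventually_happens[of _ sequentially] by auto
    have "?d * (1 - cmod (z n))\<^sup>2 \<le> 16 * (1 - hyperbolic_deriv f (z n))"
      by (rule golusin_weak[OF assms(1-3)])
    with n have "?d * (1 - cmod (z n))\<^sup>2 \<le> 0"
      by (simp add: abs_if split: if_splits)
    moreover have "?d * (1 - cmod (z n))\<^sup>2 > 0"
      using d assms(3)[of n] by (intro mult_pos_pos) auto
    ultimately show False by simp
  qed
qed simp

end
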